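(* Let $n\ge 1$ and $h\ge n$ be integers. In the $h$-AO-SP with $n$ online candidates, the algorithm described below (Algorithm 2) is $1/2$-competitive. Algorithm 2: draw a subset $T\subseteq H$ of cardinality $n-1$ uniformly at random; when candidate $c_\ell$ arrives at round $\ell$, if $c_\ell > \max T$ then accept $c_\ell$ and terminate.
   Context: The adversarial-order secretary problem with a sample of size $h$ ($h$-AO-SP), for integers $n\ge 1$, $h\ge 0$: an adversary picks a set $C$ of $n+h$ candidates, each with a value in $\mathbb{R}_{\ge 0}$ (candidates are totally ordered by value, ties broken by a fixed consistent tie-breaker). A subset $H\subseteq C$ of cardinality $h$ (the history set) is drawn uniformly at random and given, together with $n$, to the online player upfront; $O = C\setminus H$ is the online set. The adversary then chooses an order $c_1,\dots,c_n$ of $O$ (which may depend on $H$), and the candidates are revealed one by one; after each arrival the player must irrevocably accept or reject the current candidate, and accepting terminates the process. $\mathrm{ALG}$ denotes the value of the accepted candidate (0 if none) and $\mathrm{OPT}=\max O$. An algorithm is $c$-competitive if for every $C$ and every adversarial ordering strategy $\mathbb{E}[\mathrm{ALG}]\ge c\,\mathbb{E}[\mathrm{OPT}]$, the expectation being over the random choice of $H$ and the algorithm's internal randomness. (The convention $\max\emptyset$ smaller than every value applies when $n=1$.) *)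

theory Defs
  imports "HOL-Probability.Probability" "HOL-Combinatorics.Multiset_Permutations"
begin

(* A candidate carries its value and a label that serves only to break ties.  The instance
   below is the lexicographic order; it is declared on a separate type because HOL-Analysis
   already puts the componentwise order on products. *)
datatype 'b candidate = Candidate (val: real) (label: 'b)

instantiation candidate :: (linorder) linorder
begin

definition less_candidate :: "'a candidate \<Rightarrow> 'a candidate \<Rightarrow> bool" where
  "x < y \<longleftrightarrow> val x < val y \<or> (val x = val y \<and> label x < label y)"

definition less_eq_candidate :: "'a candidate \<Rightarrow> 'a candidate \<Rightarrow> bool" where
  "x \<le> y \<longleftrightarrow> x < y \<or> x = (y :: 'a candidate)"

instance
proof
  fix x y :: "'a candidate"
  show "x \<le> y \<or> y \<le> x"
    by (cases x; cases y) (auto simp: less_candidate_def less_eq_candidate_def)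
qed (auto simp: less_candidate_def less_eq_candidate_def)

end

(* A decision rule is applied to the nonempty list of online candidates revealed so far, in order
   of arrival, and says whether the last of them is accepted. *)
type_synonym 'b decision_rule = "'b candidate list \<Rightarrow> bool"

(* The player's input before the first arrival is n and the history set; the internal
   randomness is the choice of a decision rule. *)
type_synonym 'b online_algorithm = "nat \<Rightarrow> 'b candidate set \<Rightarrow> 'b decision_rule pmf"

fun play :: "'b decision_rule \<Rightarrow> 'b candidate list \<Rightarrow> 'b candidate list \<Rightarrow> real" where
  "play d seen [] = 0"
| "play d seen (c # cs) = (if d (seen @ [c]) then val c else play d (seen @ [c]) cs)"

definition instances :: "nat \<Rightarrow> nat \<Rightarrow> 'b candidate set set" where
  "instances n h = {C. finite C \<and> card C = n + h \<and> (\<forall>c\<in>C. val c \<ge> 0)}"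

definition subsets_of_card :: "'a set \<Rightarrow> nat \<Rightarrow> 'a set set" where
  "subsets_of_card A k = {S. S \<subseteq> A \<and> card S = k}"

(* The order chosen by the adversary may depend on the history set, but not on the
   algorithm's internal randomness. *)
definition ordering_strategies ::
    "nat \<Rightarrow> 'b candidate set \<Rightarrow> ('b candidate set \<Rightarrow> 'b candidate list) set" where
  "ordering_strategies h C =
     {\<sigma>. \<forall>H\<in>subsets_of_card C h. \<sigma> H \<in> permutations_of_set (C - H)}"

definition ALG ::
    "nat \<Rightarrow> nat \<Rightarrow> 'b candidate set \<Rightarrow> ('b candidate set \<Rightarrow> 'b candidate list)
      \<Rightarrow> 'b online_algorithm \<Rightarrow> real pmf" where
  "ALG n h C \<sigma> A = do {
     H \<leftarrow> pmf_of_set (subsets_of_card C h);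
     d \<leftarrow> A n H;
     return_pmf (play d [] (\<sigma> H))
   }"

definition OPT :: "nat \<Rightarrow> ('b :: linorder) candidate set \<Rightarrow> real pmf" where
  "OPT h C = do {
     H \<leftarrow> pmf_of_set (subsets_of_card C h);
     return_pmf (val (Max (C - H)))
   }"

definition competitive :: "real \<Rightarrow> nat \<Rightarrow> nat \<Rightarrow> ('b :: linorder) online_algorithm \<Rightarrow> bool" where
  "competitive c n h A \<longleftrightarrow>
     (\<forall>C\<in>instances n h. \<forall>\<sigma>\<in>ordering_strategies h C.
        measure_pmf.expectation (ALG n h C \<sigma> A) (\<lambda>x. x)
          \<ge> c * measure_pmf.expectation (OPT h C) (\<lambda>x. x))"

(* The maximum of the empty set counts as smaller than every candidate. *)
definition exceeds_max :: "'a :: linorder \<Rightarrow> 'a set \<Rightarrow> bool" where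
  "exceeds_max c T \<longleftrightarrow> T = {} \<or> c > Max T"

definition threshold_algorithm :: "('b :: linorder) online_algorithm" where
  "threshold_algorithm n H = do {
     T \<leftarrow> pmf_of_set (subsets_of_card H (n - 1));
     return_pmf (\<lambda>seen. exceeds_max (last seen) T)
   }"

end

theory Submission
  imports Defs
begin

text \<open>The set \<open>S = O \<union> T\<close> has \<open>2n - 1\<close> elements, and conditionally on \<open>S\<close> the set \<open>T\<close> is a uniformly
  random \<open>(n-1)\<close>-subset of \<open>S\<close>. For fixed \<open>S\<close> we compare the tails of \<open>ALG\<close> and \<open>OPT\<close> at each level
  \<open>t\<close>. Let \<open>A\<close> be the set of the \<open>k\<close> elements of \<open>S\<close> of value at least \<open>t\<close> and let \<open>A\<^sup>+\<close> be \<open>A\<close> together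
  with the next largest element. Then \<open>OPT \<ge> t\<close> unless \<open>S - T\<close> misses \<open>A\<close>, while the algorithm
  certainly gets at least \<open>t\<close> if \<open>Max S \<notin> T\<close> and \<open>T\<close> meets \<open>A\<^sup>+\<close>, whatever the order. Counting
  the sets \<open>T\<close>, the comparison becomes a monotonicity property of ballot numbers.\<close>

section \<open>Comparing sums through their tails\<close>

text \<open>A nonnegative real is the length of the set of levels \<open>t > 0\<close> not exceeding
  it, so each sum is the integral over \<open>t\<close> of its tail counts and the hypothesis can be
  integrated.\<close>

lemma sum_le_sum_of_tails:
  fixes f g :: "'i \<Rightarrow> real"
  assumes "finite I" and f: "\<And>i. i \<in> I \<Longrightarrow> f i \<ge> 0" and g: "\<And>i. i \<in> I \<Longrightarrow> g i \<ge> 0"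
    and tails: "\<And>t. t > 0 \<Longrightarrow> real (card {i \<in> I. t \<le> g i}) \<le> c * real (card {i \<in> I. t \<le> f i})"
  shows "sum g I \<le> c * sum f I"
proof -
  have int: "integrable lborel (indicat_real {0<..a})" for a :: real
    by (cases "0 \<le> a") (simp_all add: integrable_real_indicator)
  have layers: "sum u I = (\<integral>t. (\<Sum>i\<in>I. indicat_real {0<..u i} t) \<partial>lborel)"
    if "\<And>i. i \<in> I \<Longrightarrow> u i \<ge> 0" for u :: "'i \<Rightarrow> real"
    using that by (simp add: int)
  have card: "(\<Sum>i\<in>I. indicat_real {0<..u i} t) = (if t > 0 then real (card {i \<in> I. t \<le> u i}) else 0)"
    for u :: "'i \<Rightarrow> real" and t
    using \<open>finite I\<close> by (auto simp: indicator_def sum.If_cases Int_def)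
  have "sum g I = (\<integral>t. (\<Sum>i\<in>I. indicat_real {0<..g i} t) \<partial>lborel)"
    by (rule layers[OF g])
  also have "\<dots> \<le> (\<integral>t. c * (\<Sum>i\<in>I. indicat_real {0<..f i} t) \<partial>lborel)"
  proof (rule integral_mono)
    show "(\<Sum>i\<in>I. indicat_real {0<..g i} t) \<le> c * (\<Sum>i\<in>I. indicat_real {0<..f i} t)" for t
      by (simp add: card tails)
  qed (simp_all add: int)
  also have "\<dots> = c * sum f I"
    using layers[OF f] by simp
  finally show ?thesis .
qed

section \<open>Binomial estimates and counts of subsets\<close>

text \<open>The ballot numbers \<open>(2m-k choose m) - (2m-k choose m+1)\<close> decrease in \<open>k\<close>; the statement is
  arranged so that no difference of binomial coefficients is truncated.\<close>

lemma ballot_number_le: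
  assumes "k \<le> 2 * m"
  shows "(2*m - k choose m) + (2*m choose Suc m) \<le> (2*m choose m) + (2*m - k choose Suc m)"
  using assms
proof (induction k)
  case (Suc k)
  define N where "N = 2*m - Suc k"
  obtain l where m: "m = Suc l"
    using Suc.prems by (cases m) auto
  have N: "2*m - k = Suc N" "2*m - Suc k = N"
    using Suc.prems by (auto simp: N_def)
  \<comment> \<open>\<open>N\<close> is at most \<open>2*l + 1\<close>, so row \<open>N\<close> does
    not increase from \<open>l\<close> to \<open>m\<close>. By Pascal's rule the gap between the two
    entries is the drop of the ballot number from \<open>k\<close> to \<open>Suc k\<close>.\<close>
  have "N choose m \<le> N choose l"
  proof (cases "m \<le> N")
    case True
    then show ?thesis
      by (intro binomial_antimono) (use m N_def in auto)
  qed (simp add: binomial_eq_0)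
  moreover have "(Suc N choose m) = (N choose l) + (N choose m)"
    "(Suc N choose Suc m) = (N choose m) + (N choose Suc m)"
    by (simp_all add: m)
  ultimately show ?case
    using Suc.IH Suc.prems unfolding N by linarith
qed simp

lemma card_subsets_inter_empty:
  assumes "finite S" "A \<subseteq> S"
  shows "card {T \<in> subsets_of_card S k. T \<inter> A = {}} = (card S - card A choose k)"
proof -
  have "{T \<in> subsets_of_card S k. T \<inter> A = {}} = {T. T \<subseteq> S - A \<and> card T = k}"
    by (auto simp: subsets_of_card_def)
  then show ?thesis
    using assms by (simp add: n_subsets card_Diff_subset finite_subset)
qed

lemma finite_subsets_of_card: "finite S \<Longrightarrow> finite (subsets_of_card S k)"
  by (simp add: subsets_of_card_def)

lemma card_subsets_of_card: "finite S \<Longrightarrow> card (subsets_of_card S k) = (card S choose k)"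
  by (simp add: subsets_of_card_def n_subsets)

text \<open>Complementation in \<open>S\<close> turns the \<open>m\<close>-subsets whose complement
  misses \<open>A\<close> into the \<open>Suc k\<close>-subsets missing \<open>A\<close>. The
  additive form avoids truncated subtraction.\<close>

lemma card_subsets_diff_meets:
  assumes S: "finite S" "card S = Suc (m + k)" and "A \<subseteq> S"
  shows "card {T \<in> subsets_of_card S m. (S - T) \<inter> A \<noteq> {}} + (card S - card A choose Suc k)
    = (card S choose m)"
proof -
  have "bij_betw (\<lambda>T. S - T) {T \<in> subsets_of_card S m. (S - T) \<inter> A = {}}
      {U \<in> subsets_of_card S (Suc k). U \<inter> A = {}}"
    by (rule bij_betw_byWitness[where f' = "\<lambda>T. S - T"])
      (use S in \<open>auto simp: subsets_of_card_def card_Diff_subset finite_subset\<close>)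
  then have "card {T \<in> subsets_of_card S m. (S - T) \<inter> A = {}} = (card S - card A choose Suc k)"
    by (simp add: bij_betw_same_card card_subsets_inter_empty[OF S(1) \<open>A \<subseteq> S\<close>])
  moreover have "subsets_of_card S m = {T \<in> subsets_of_card S m. (S - T) \<inter> A \<noteq> {}}
      \<union> {T \<in> subsets_of_card S m. (S - T) \<inter> A = {}}"
    by blast
  then have "card (subsets_of_card S m) = card {T \<in> subsets_of_card S m. (S - T) \<inter> A \<noteq> {}}
      + card {T \<in> subsets_of_card S m. (S - T) \<inter> A = {}}"
    by (subst card_Un_disjoint[symmetric]) (auto simp: finite_subsets_of_card[OF S(1)])
  ultimately show ?thesis
    using card_subsets_of_card[OF S(1)] by simp
qed

section \<open>What a threshold rule collects\<close>

lemma play_threshold: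
  "play (\<lambda>seen. P (last seen)) seen cs = (case find P cs of None \<Rightarrow> 0 | Some c \<Rightarrow> val c)"
  by (induction cs arbitrary: seen) auto

lemma find_SomeD: "find P xs = Some x \<Longrightarrow> x \<in> set xs \<and> P x"
  by (auto simp: find_Some_iff)

text \<open>This neutralises the adversary: \<open>x\<close> guarantees that something is accepted,
  and a bound valid for all acceptable candidates holds for whichever comes first.\<close>

lemma play_ge:
  assumes "x \<in> set cs" "P x" "\<And>c. c \<in> set cs \<Longrightarrow> P c \<Longrightarrow> t \<le> val c"
  shows "t \<le> play (\<lambda>seen. P (last seen)) seen cs"
  using assms by (auto simp: play_threshold find_None_iff split: option.split dest!: find_SomeD)

lemma play_nonneg:
  assumes "\<And>c. c \<in> set cs \<Longrightarrow> 0 \<le> val c"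
  shows "0 \<le> play (\<lambda>seen. P (last seen)) seen cs"
  using assms by (auto simp: play_threshold split: option.split dest!: find_SomeD)

lemma val_mono: "x \<le> y \<Longrightarrow> val x \<le> val y"
  by (auto simp: less_eq_candidate_def less_candidate_def)

section \<open>Comparison for a fixed set \<open>S\<close>\<close>

text \<open>With \<open>k = card A\<close>, the first count is at most
  \<open>(2*m+1 choose m) - (2*m+1-k choose m+1)\<close> and, if \<open>A \<noteq> S\<close>, the
  second is at least \<open>(2*m choose m) - (2*m-k choose m)\<close>. Pascal's rule then reduces
  the claim to \<open>ballot_number_le\<close>.\<close>

lemma opt_tail_le_threshold_tail:
  fixes S :: "('b :: linorder) candidate set"
  assumes S: "finite S" "card S = 2*m + 1"
    and \<pi>: "\<And>T. T \<in> subsets_of_card S m \<Longrightarrow> set (\<pi> T) = S - T"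
  shows "card {T \<in> subsets_of_card S m. t \<le> val (Max (S - T))}
    \<le> 2 * card {T \<in> subsets_of_card S m. t \<le> play (\<lambda>seen. exceeds_max (last seen) T) [] (\<pi> T)}"
    (is "card ?Opt \<le> 2 * card ?Alg")
proof -
  define A where "A = {s \<in> S. t \<le> val s}"
  define s where "s = Max S"
  have "S \<noteq> {}"
    using S by auto
  then have "s \<in> S" and s_max: "\<And>x. x \<in> S \<Longrightarrow> x \<le> s"
    using S by (auto simp: s_def)
  note fin = finite_subsets_of_card[OF S(1), of m]
  have A: "A \<subseteq> S" "finite A" "card A \<le> 2*m + 1"
    using S card_mono[of S A] by (auto simp: A_def)
  have T: "T \<subseteq> S" "finite T" "S - T \<noteq> {}" if "T \<in> subsets_of_card S m" for T
  proof -
    show "T \<subseteq> S" and "finite T"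
      using that S by (auto simp: subsets_of_card_def finite_subset)
    have "T \<noteq> S"
      using that S by (auto simp: subsets_of_card_def)
    with \<open>T \<subseteq> S\<close> show "S - T \<noteq> {}"
      by blast
  qed
  have "?Opt \<subseteq> {T \<in> subsets_of_card S m. (S - T) \<inter> A \<noteq> {}}"
  proof safe
    fix T assume *: "T \<in> subsets_of_card S m" "t \<le> val (Max (S - T))" "(S - T) \<inter> A = {}"
    have "Max (S - T) \<in> S - T"
      using T[OF *(1)] S by (intro Max_in) auto
    with * show False
      by (auto simp: A_def)
  qed
  then have "card ?Opt \<le> card {T \<in> subsets_of_card S m. (S - T) \<inter> A \<noteq> {}}"
    using fin by (intro card_mono) auto
  with card_subsets_diff_meets[OF S(1) _ A(1), of m m] S
  have opt: "card ?Opt + (2*m + 1 - card A choose Suc m) \<le> (2*m + 1 choose m)"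
    by simp
  have binom: "(2*m + 1 choose m) = (2*m choose m) + (2*m choose Suc m)"
    using binomial_symmetric[of m "2*m + 1"] by simp
  have s_notin: "card {T \<in> subsets_of_card S m. s \<notin> T} = (2*m choose m)"
    using card_subsets_inter_empty[of S "{s}" m] S \<open>s \<in> S\<close> by simp
  have s_exceeds: "exceeds_max s T" if "T \<in> subsets_of_card S m" "s \<notin> T" for T
  proof (cases "T = {}")
    case False
    then have "Max T \<in> T" "Max T \<le> s"
      using T[OF that(1)] s_max by auto
    then show ?thesis
      using that(2) by (auto simp: exceeds_max_def less_le)
  qed (simp add: exceeds_max_def)
  show ?thesis
  proof (cases "A = S")
    \<comment> \<open>There is no next largest element to add to \<open>A\<close>. Every candidate
      is worth at least \<open>t\<close>, so it suffices that \<open>s\<close> is online; the factor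
      2 comes from the central entry of row \<open>2*m\<close> being maximal.\<close>
    case True
    have "{T \<in> subsets_of_card S m. s \<notin> T} \<subseteq> ?Alg"
    proof safe
      fix T assume *: "T \<in> subsets_of_card S m" "s \<notin> T"
      show "t \<le> play (\<lambda>seen. exceeds_max (last seen) T) [] (\<pi> T)"
        by (rule play_ge[where x = s]) (use * \<pi> s_exceeds True \<open>s \<in> S\<close> in \<open>auto simp: A_def\<close>)
    qed
    then have "(2*m choose m) \<le> card ?Alg"
      unfolding s_notin[symmetric] using fin by (intro card_mono) auto
    moreover have "(2*m choose Suc m) \<le> (2*m choose m)"
      using binomial_maximum'[of m "Suc m"] by (simp add: mult.commute)
    ultimately show ?thesis
      using opt binom by linarith
  next
    case False
    define a where "a = Max (S - A)"
    have "a \<in> S - A" and a_max: "\<And>x. x \<in> S - A \<Longrightarrow> x \<le> a"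
      using False A S Max_in[of "S - A"] by (auto simp: a_def)
    then have card_A: "card (insert a A) = Suc (card A)" "insert a A \<subseteq> S"
      using A by auto
    then have "card A \<le> 2*m"
      using S card_mono[of S "insert a A"] by auto
    \<comment> \<open>An element of \<open>T\<close> in \<open>insert a A\<close> lifts the
      threshold to at least \<open>a\<close>, and everything in \<open>S\<close> above
      \<open>a\<close> lies in \<open>A\<close>. Having \<open>s\<close> online ensures an
      acceptance.\<close>
    have "{T \<in> subsets_of_card S m. s \<notin> T} - {T \<in> subsets_of_card S m. T \<inter> insert a A = {}} \<subseteq> ?Alg"
    proof
      fix T assume "T \<in> {T \<in> subsets_of_card S m. s \<notin> T}
        - {T \<in> subsets_of_card S m. T \<inter> insert a A = {}}"
      then have *: "T \<in> subsets_of_card S m" "s \<notin> T" "T \<inter> insert a A \<noteq> {}"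
        by simp_all
      then obtain x where x: "x \<in> T" "x \<in> insert a A"
        by blast
      \<comment> \<open>All of \<open>A\<close> lies above \<open>a\<close>: its values reach
        \<open>t\<close>, that of \<open>a\<close> does not.\<close>
      have "a \<le> x"
      proof (rule ccontr)
        assume "\<not> a \<le> x"
        then have "val x \<le> val a" "x \<in> A"
          using x by (auto intro: val_mono)
        with \<open>a \<in> S - A\<close> show False
          by (auto simp: A_def)
      qed
      then have "a \<le> Max T"
        using x T(2)[OF *(1)] by (meson Max_ge order_trans)
      have "t \<le> val c" if "c \<in> S" "exceeds_max c T" for c
      proof -
        have "a < c"
          using that x \<open>a \<le> Max T\<close> by (auto simp: exceeds_max_def)
        then have "c \<notin> S - A"
          using a_max[of c] by (auto simp: not_le[symmetric])
        with \<open>c \<in> S\<close> show ?thesis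
          by (auto simp: A_def)
      qed
      then have "t \<le> play (\<lambda>seen. exceeds_max (last seen) T) [] (\<pi> T)"
        by (intro play_ge[where x = s]) (use * \<pi> s_exceeds \<open>s \<in> S\<close> in auto)
      with * show "T \<in> ?Alg"
        by simp
    qed
    then have "card ({T \<in> subsets_of_card S m. s \<notin> T}
        - {T \<in> subsets_of_card S m. T \<inter> insert a A = {}}) \<le> card ?Alg"
      using fin by (intro card_mono) auto
    moreover have "card {T \<in> subsets_of_card S m. T \<inter> insert a A = {}} = (2*m - card A choose m)"
      using card_subsets_inter_empty[OF S(1) card_A(2), of m] card_A(1) S(2) by simp
    ultimately have alg: "(2*m choose m) \<le> card ?Alg + (2*m - card A choose m)"
      using s_notin diff_card_le_card_Diff[of "{T \<in> subsets_of_card S m. T \<inter> insert a A = {}}"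
          "{T \<in> subsets_of_card S m. s \<notin> T}"] fin by simp
    have "(2*m + 1 - card A choose Suc m) = (2*m - card A choose m) + (2*m - card A choose Suc m)"
      using \<open>card A \<le> 2*m\<close> by (simp add: Suc_diff_le)
    then show ?thesis
      using alg opt binom ballot_number_le[OF \<open>card A \<le> 2*m\<close>] by linarith
  qed
qed

lemma sum_opt_le_sum_threshold:
  fixes S :: "('b :: linorder) candidate set"
  assumes S: "finite S" "card S = 2*m + 1" and nonneg: "\<And>c. c \<in> S \<Longrightarrow> val c \<ge> 0"
    and \<pi>: "\<And>T. T \<in> subsets_of_card S m \<Longrightarrow> set (\<pi> T) = S - T"
  shows "(\<Sum>T\<in>subsets_of_card S m. val (Max (S - T)))
    \<le> 2 * (\<Sum>T\<in>subsets_of_card S m. play (\<lambda>seen. exceeds_max (last seen) T) [] (\<pi> T))"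
proof (rule sum_le_sum_of_tails)
  fix T assume T: "T \<in> subsets_of_card S m"
  then show "0 \<le> play (\<lambda>seen. exceeds_max (last seen) T) [] (\<pi> T)"
    using nonneg \<pi> by (intro play_nonneg) auto
  have "T \<subseteq> S" "T \<noteq> S"
    using T S(2) by (auto simp: subsets_of_card_def)
  then have "Max (S - T) \<in> S - T"
    using S(1) by (intro Max_in) auto
  then show "0 \<le> val (Max (S - T))"
    using nonneg by auto
next
  fix t :: real
  show "real (card {T \<in> subsets_of_card S m. t \<le> val (Max (S - T))}) \<le> 2 * real (card
      {T \<in> subsets_of_card S m. t \<le> play (\<lambda>seen. exceeds_max (last seen) T) [] (\<pi> T)})"
    using opt_tail_le_threshold_tail[OF S \<pi>, of t] by linarith
qed (use S finite_subsets_of_card in auto)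

section \<open>Conditioning on the union of online set and sample\<close>

text \<open>The map from \<open>(H, T)\<close> to \<open>(C - H \<union> T, T)\<close> is its own
  inverse because \<open>T \<subseteq> H\<close>. This is the double counting behind the uniformity
  of \<open>T\<close> given \<open>S\<close>.\<close>

lemma sum_subsets_exchange:
  fixes F :: "'a set \<Rightarrow> 'a set \<Rightarrow> real"
  assumes C: "finite C" "card C = Suc m + h"
  shows "(\<Sum>H\<in>subsets_of_card C h. \<Sum>T\<in>subsets_of_card H m. F H T)
    = (\<Sum>S\<in>subsets_of_card C (2*m + 1). \<Sum>T\<in>subsets_of_card S m. F (C - S \<union> T) T)"
proof -
  define flip where "flip = (\<lambda>(X, T). (C - X \<union> T, T))"
  let ?P = "\<lambda>k. Sigma (subsets_of_card C k) (\<lambda>X. subsets_of_card X m)"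
  have fin: "finite H" if "H \<in> subsets_of_card C k" for H k
    using that C by (auto simp: subsets_of_card_def finite_subset)
  have flip_flip: "flip (flip p) = p" if "p \<in> ?P k" for p k
    using that by (auto simp: flip_def subsets_of_card_def)
  \<comment> \<open>Sizes \<open>k\<close> and \<open>l\<close> are exchanged, so one argument
    serves both directions between \<open>h\<close> and \<open>2*m + 1\<close>.\<close>
  have flip_in: "flip p \<in> ?P l" if p: "p \<in> ?P k" and kl: "k + l = Suc (2*m + h)" for p k l
  proof -
    obtain X T where XT: "p = (X, T)" "X \<subseteq> C" "card X = k" "T \<subseteq> X" "card T = m"
      using p by (auto simp: subsets_of_card_def)
    then have "finite X" "finite T"
      using C(1) by (auto intro: finite_subset)
    with XT have "card (C - X \<union> T) = card C - k + m"
      using C(1) by (subst card_Un_disjoint) (auto simp: card_Diff_subset)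
    moreover have "k \<le> card C"
      using XT C(1) card_mono by blast
    ultimately have "card (C - X \<union> T) = l"
      using C(2) kl by linarith
    then show ?thesis
      using XT by (auto simp: flip_def subsets_of_card_def)
  qed
  have "(\<Sum>(H, T)\<in>?P h. F H T) = (\<Sum>(S, T)\<in>?P (2*m + 1). F (C - S \<union> T) T)"
  proof (rule sum.reindex_bij_witness[where i = flip and j = flip])
    fix p assume "p \<in> ?P h"
    then have "flip (flip p) = p"
      by (rule flip_flip)
    then show "(case flip p of (S, T) \<Rightarrow> F (C - S \<union> T) T) = (case p of (H, T) \<Rightarrow> F H T)"
      by (auto simp: flip_def split: prod.splits)
  qed (auto simp only: flip_flip intro!: flip_in)
  then show ?thesis
    using C fin by (simp add: sum.Sigma finite_subsets_of_card)
qed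

section \<open>Expectations and the competitive ratio\<close>

lemma expectation_pmf_of_set_bind:
  fixes f :: "'b \<Rightarrow> real"
  assumes "finite A" "A \<noteq> {}" "\<And>x. x \<in> A \<Longrightarrow> finite (set_pmf (p x))"
  shows "measure_pmf.expectation (pmf_of_set A \<bind> p) f
    = (\<Sum>x\<in>A. measure_pmf.expectation (p x) f) / card A"
  using assms
  by (subst pmf_expectation_bind[of "A"])
    (simp_all add: divide_inverse sum_distrib_left mult.commute)

theorem theorem3:
  fixes n h :: nat
  assumes "n \<ge> 1" and "h \<ge> n"
  shows "competitive (1/2) n h (threshold_algorithm :: ('b :: linorder) online_algorithm)"
  unfolding competitive_def
proof (intro ballI)
  fix C :: "'b candidate set" and \<sigma>
  assume "C \<in> instances n h" and \<sigma>: "\<sigma> \<in> ordering_strategies h C"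
  define m where "m = n - 1"
  then have m: "n = Suc m"
    using assms by simp
  have C: "finite C" "card C = Suc m + h" and nonneg: "\<And>c. c \<in> C \<Longrightarrow> val c \<ge> 0"
    using \<open>C \<in> instances n h\<close> by (auto simp: instances_def m)
  have set_\<sigma>: "set (\<sigma> H) = C - H" if "H \<in> subsets_of_card C h" for H
    using \<sigma> that by (auto simp: ordering_strategies_def permutations_of_set_def)
  define g where "g H T = play (\<lambda>seen. exceeds_max (last seen) T) [] (\<sigma> H)" for H T
  let ?Hs = "subsets_of_card C h"
  have Hs: "finite ?Hs" "?Hs \<noteq> {}"
    using C card_subsets_of_card[OF C(1), of h] finite_subsets_of_card by fastforce+
  have Ts: "finite (subsets_of_card H m)" "subsets_of_card H m \<noteq> {}"
    "card (subsets_of_card H m) = (h choose m)" if "H \<in> ?Hs" for H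
  proof -
    have "finite H" "card H = h"
      using that C by (auto simp: subsets_of_card_def finite_subset)
    then show "finite (subsets_of_card H m)" "card (subsets_of_card H m) = (h choose m)"
      by (simp_all add: finite_subsets_of_card card_subsets_of_card)
    \<comment> \<open>\<open>pmf_of_set\<close> is meaningful only on a nonempty set;
      \<open>h \<ge> n\<close> provides a sample of size \<open>m = n - 1\<close>.\<close>
    then show "subsets_of_card H m \<noteq> {}"
      using assms m by (metis Suc_leD card.empty order_less_irrefl zero_less_binomial)
  qed
  have choose_pos: "real (h choose m) > 0"
    using assms m by simp
  have alg: "measure_pmf.expectation (ALG n h C \<sigma> threshold_algorithm) (\<lambda>x. x)
      = (\<Sum>H\<in>?Hs. \<Sum>T\<in>subsets_of_card H m. g H T) / (h choose m) / card ?Hs"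
  proof -
    have *: "measure_pmf.expectation (threshold_algorithm n H \<bind> (\<lambda>d. return_pmf (play d [] (\<sigma> H)))) (\<lambda>x. x)
        = (\<Sum>T\<in>subsets_of_card H m. g H T) / (h choose m)" if "H \<in> ?Hs" for H
      using Ts[OF that]
      by (simp add: threshold_algorithm_def m bind_assoc_pmf bind_return_pmf
          expectation_pmf_of_set_bind g_def)
    show ?thesis
      unfolding ALG_def using Hs Ts
      by (subst expectation_pmf_of_set_bind)
        (simp_all add: * flip: sum_divide_distrib, simp add: threshold_algorithm_def m)
  qed
  have "measure_pmf.expectation (OPT h C) (\<lambda>x. x) = (\<Sum>H\<in>?Hs. val (Max (C - H))) / card ?Hs"
    using Hs by (simp add: OPT_def expectation_pmf_of_set_bind)
  \<comment> \<open>The optimum does not depend on \<open>T\<close>; repeating it for each of the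
    \<open>h choose m\<close> samples gives both expectations the same index set and
    denominator.\<close>
  also have "(\<Sum>H\<in>?Hs. val (Max (C - H)))
      = (\<Sum>H\<in>?Hs. \<Sum>T\<in>subsets_of_card H m. val (Max (C - H))) / (h choose m)"
    using Ts choose_pos by (simp add: sum_divide_distrib)
  finally have opt: "measure_pmf.expectation (OPT h C) (\<lambda>x. x)
      = (\<Sum>H\<in>?Hs. \<Sum>T\<in>subsets_of_card H m. val (Max (C - H))) / (h choose m) / card ?Hs" .
  have "(\<Sum>H\<in>?Hs. \<Sum>T\<in>subsets_of_card H m. val (Max (C - H)))
      = (\<Sum>S\<in>subsets_of_card C (2*m + 1). \<Sum>T\<in>subsets_of_card S m. val (Max (C - (C - S \<union> T))))"
    by (rule sum_subsets_exchange[OF C])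
  also have "\<dots> \<le> (\<Sum>S\<in>subsets_of_card C (2*m + 1). 2 * (\<Sum>T\<in>subsets_of_card S m. g (C - S \<union> T) T))"
  proof (rule sum_mono)
    fix S assume "S \<in> subsets_of_card C (2*m + 1)"
    then have S: "S \<subseteq> C" "finite S" "card S = 2*m + 1"
      using C by (auto simp: subsets_of_card_def finite_subset)
    have diff: "C - (C - S \<union> T) = S - T" for T
      using S by blast
    \<comment> \<open>For fixed \<open>S\<close> the history set is \<open>C - S \<union> T\<close>,
      so the adversary's order becomes a function of \<open>T\<close>, as
      \<open>sum_opt_le_sum_threshold\<close> allows.\<close>
    have "set (\<sigma> (C - S \<union> T)) = S - T" if "T \<in> subsets_of_card S m" for T
    proof -
      have "T \<subseteq> S" "card T = m" "finite T"
        using that S by (auto simp: subsets_of_card_def finite_subset)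
      then have "card (C - S \<union> T) = card (C - S) + m"
        using C by (subst card_Un_disjoint) auto
      also have "\<dots> = h"
        using S C assms m by (simp add: card_Diff_subset)
      finally have "C - S \<union> T \<in> ?Hs"
        using \<open>T \<subseteq> S\<close> S by (auto simp: subsets_of_card_def)
      then show ?thesis
        by (simp add: set_\<sigma> diff)
    qed
    then show "(\<Sum>T\<in>subsets_of_card S m. val (Max (C - (C - S \<union> T))))
        \<le> 2 * (\<Sum>T\<in>subsets_of_card S m. g (C - S \<union> T) T)"
      unfolding g_def diff using S nonneg by (intro sum_opt_le_sum_threshold) auto
  qed
  also have "\<dots> = 2 * (\<Sum>H\<in>?Hs. \<Sum>T\<in>subsets_of_card H m. g H T)"
    by (simp only: sum_subsets_exchange[OF C] sum_distrib_left)
  finally show "1/2 * measure_pmf.expectation (OPT h C) (\<lambda>x. x)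
      \<le> measure_pmf.expectation (ALG n h C \<sigma> threshold_algorithm) (\<lambda>x. x)"
    unfolding alg opt using divide_right_mono[of _ _ "2 * (real (h choose m) * real (card ?Hs))"]
    by fastforce
qed

end
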